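(* Let $\mathcal{D}=(V,\mathscr{E})$ be a directed acyclic graph. Every partial positive definite matrix over $\mathcal{D}$ (i.e. every $\Gamma\in \mathrm{Q}_{\mathcal{D}}$) can be completed in $\mathrm{PD}_{\mathcal{D}}$ if and only if $\mathcal{D}$ is a perfect DAG.
   Context: $\mathcal{D}=(V,\mathscr{E})$ is a directed acyclic graph (DAG: a directed graph with no directed cycles of length greater than 1) on $V=\{1,\dots,p\}$, with vertices numbered so that $i\to j$ (i.e. $(i,j)\in\mathscr{E}$, $i\ne j$) implies $i>j$. By convention edge sets contain all loops $(i,i)$. $\mathrm{pa}(j)=\{i\neq j: i\to j\}$ is the set of parents of $j$, and $\mathrm{pr}(j)=\{i: i>j,\ i\notin \mathrm{pa}(j)\}$ is the set of predecessors. $\mathcal{D}$ is perfect if for each vertex any two distinct parents are adjacent (joined by an edge), i.e. there is no induced subgraph $i\to k\leftarrow j$. The undirected version of $\mathcal{D}$, obtained by replacing directed edges by undirected ones, is $\mathcal{G}=(V,\mathscr{V})$. A $\mathcal{D}$-partial matrix is a real symmetric function $\Gamma$ on $\{(i,j):\{i,j\}\in\mathscr{V}\}$ (including all diagonal positions), $\Gamma_{ij}=\Gamma_{ji}$. A clique of $\mathcal{D}$ is a maximal set of pairwise adjacent vertices. A partial positive definite matrix over $\mathcal{D}$ is a $\mathcal{D}$-partial matrix $\Gamma$ such that $\Gamma_C=(\Gamma_{ij})_{i,j\in C}$ is positive definite for every clique $C$ of $\mathcal{D}$; the set of these is $\mathrm{Q}_{\mathcal{D}}$. $\Sigma_{A,B}$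 denotes the submatrix of $\Sigma$ with rows in $A$ and columns in $B$, and $\Sigma_A=\Sigma_{A,A}$. $\mathrm{PD}_{\mathcal{D}}$ is the set of $p\times p$ covariance matrices $\Sigma\succ 0$ such that the Gaussian distribution $\mathrm{N}_p(0,\Sigma)$ obeys the directed local Markov property with respect to $\mathcal{D}$; equivalently, $\Sigma\in\mathrm{PD}_{\mathcal{D}}$ iff $\Sigma$ is symmetric positive definite and $\Sigma_{\mathrm{pr}(j),j}=\Sigma_{\mathrm{pr}(j),\mathrm{pa}(j)}(\Sigma_{\mathrm{pa}(j)})^{-1}\Sigma_{\mathrm{pa}(j),j}$ for all $j\in V$, where the right-hand side is $0$ if $\mathrm{pa}(j)=\emptyset$. $\Gamma$ can be completed in a set $\mathcal{M}$ of symmetric $p\times p$ matrices if there is $T\in\mathcal{M}$ with $T_{ij}=\Gamma_{ij}$ for each $(i,j)\in\mathscr{E}$ (loops included, so diagonals agree). *)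

theory Defs
  imports Complex_Main
begin

(* Matrices with rows and columns labelled by {1..p} are functions nat => nat => real; only the
   entries with both indices in {1..p} matter.  The submatrix M_{A,B} is M restricted to A x B,
   so it keeps the vertex labels. *)

(* The last condition is the vertex numbering (parents carry larger labels). *)
definition dag :: "nat \<Rightarrow> (nat \<times> nat) set \<Rightarrow> bool" where
  "dag p E \<longleftrightarrow>
     E \<subseteq> {1..p} \<times> {1..p} \<and>
     (\<forall>i\<in>{1..p}. (i, i) \<in> E) \<and>
     acyclic (E - Id) \<and>
     (\<forall>i j. (i, j) \<in> E \<and> i \<noteq> j \<longrightarrow> i > j)"

definition pa :: "(nat \<times> nat) set \<Rightarrow> nat \<Rightarrow> nat set" where
  "pa E j = {i. i \<noteq> j \<and> (i, j) \<in> E}"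

definition pr :: "nat \<Rightarrow> (nat \<times> nat) set \<Rightarrow> nat \<Rightarrow> nat set" where
  "pr p E j = {i \<in> {1..p}. i > j \<and> i \<notin> pa E j}"

(* Loops of E become the singletons {i}. *)
definition undirected_edges :: "(nat \<times> nat) set \<Rightarrow> nat set set" where
  "undirected_edges E = {{i, j} | i j. (i, j) \<in> E}"

definition perfect_dag :: "nat \<Rightarrow> (nat \<times> nat) set \<Rightarrow> bool" where
  "perfect_dag p E \<longleftrightarrow> dag p E \<and>
     (\<forall>k\<in>{1..p}. \<forall>i\<in>pa E k. \<forall>j\<in>pa E k. i \<noteq> j \<longrightarrow> {i, j} \<in> undirected_edges E)"

definition pairwise_adjacent :: "nat \<Rightarrow> (nat \<times> nat) set \<Rightarrow> nat set \<Rightarrow> bool" where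
  "pairwise_adjacent p E C \<longleftrightarrow>
     C \<subseteq> {1..p} \<and> (\<forall>i\<in>C. \<forall>j\<in>C. i \<noteq> j \<longrightarrow> {i, j} \<in> undirected_edges E)"

definition clique :: "nat \<Rightarrow> (nat \<times> nat) set \<Rightarrow> nat set \<Rightarrow> bool" where
  "clique p E C \<longleftrightarrow>
     pairwise_adjacent p E C \<and> (\<forall>C'. pairwise_adjacent p E C' \<and> C \<subseteq> C' \<longrightarrow> C' = C)"

(* M_A is symmetric positive definite. *)
definition pos_def_on :: "nat set \<Rightarrow> (nat \<Rightarrow> nat \<Rightarrow> real) \<Rightarrow> bool" where
  "pos_def_on A M \<longleftrightarrow>
     (\<forall>i\<in>A. \<forall>j\<in>A. M i j = M j i) \<and>
     (\<forall>x :: nat \<Rightarrow> real. (\<exists>i\<in>A. x i \<noteq> 0) \<longrightarrow> (\<Sum>i\<in>A. \<Sum>j\<in>A. x i * M i j * x j) > 0)"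

(* Values of the function at positions {i,j} that are not undirected edges are junk; nothing below
   depends on them. *)
definition partial_matrix :: "(nat \<times> nat) set \<Rightarrow> (nat \<Rightarrow> nat \<Rightarrow> real) \<Rightarrow> bool" where
  "partial_matrix E \<Gamma> \<longleftrightarrow> (\<forall>i j. {i, j} \<in> undirected_edges E \<longrightarrow> \<Gamma> i j = \<Gamma> j i)"

definition Q_dag :: "nat \<Rightarrow> (nat \<times> nat) set \<Rightarrow> (nat \<Rightarrow> nat \<Rightarrow> real) set" where
  "Q_dag p E = {\<Gamma>. partial_matrix E \<Gamma> \<and> (\<forall>C. clique p E C \<longrightarrow> pos_def_on C \<Gamma>)}"

(* The inverse of the submatrix M_A, padded with zeros outside A x A so that it is unique;
   meaningful only when M_A is invertible. *)
definition submatrix_inv :: "nat set \<Rightarrow> (nat \<Rightarrow> nat \<Rightarrow> real) \<Rightarrow> nat \<Rightarrow> nat \<Rightarrow> real" where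
  "submatrix_inv A M = (THE N.
     (\<forall>i\<in>A. \<forall>j\<in>A. (\<Sum>k\<in>A. M i k * N k j) = (if i = j then 1 else 0)) \<and>
     (\<forall>i\<in>A. \<forall>j\<in>A. (\<Sum>k\<in>A. N i k * M k j) = (if i = j then 1 else 0)) \<and>
     (\<forall>i j. i \<notin> A \<or> j \<notin> A \<longrightarrow> N i j = 0))"

(* The equation is the directed local Markov property of the centred Gaussian with covariance S,
     S_{pr(j),j} = S_{pr(j),pa(j)} (S_{pa(j)})^{-1} S_{pa(j),j},
   written entrywise; for pa(j) empty the right-hand side is the empty sum 0. *)
definition PD_dag :: "nat \<Rightarrow> (nat \<times> nat) set \<Rightarrow> (nat \<Rightarrow> nat \<Rightarrow> real) set" where
  "PD_dag p E = {S. pos_def_on {1..p} S \<and>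
     (\<forall>j\<in>{1..p}. \<forall>i\<in>pr p E j.
        S i j = (\<Sum>k\<in>pa E j. \<Sum>l\<in>pa E j. S i k * submatrix_inv (pa E j) S k l * S l j))}"

definition completable_in ::
    "(nat \<times> nat) set \<Rightarrow> (nat \<Rightarrow> nat \<Rightarrow> real) \<Rightarrow> (nat \<Rightarrow> nat \<Rightarrow> real) set \<Rightarrow> bool" where
  "completable_in E \<Gamma> \<M> \<longleftrightarrow> (\<exists>T\<in>\<M>. \<forall>(i, j)\<in>E. T i j = \<Gamma> i j)"

end

theory Submission
  imports Defs
begin

text \<open>
  If the graph is perfect, a completion is built by adding the vertices in the order \<open>p, \<dots>, 1\<close>.
  The Markov equation forces the new column to be \<open>\<Sigma>\<^sub>{.,pa(j)} b\<close> with
  \<open>b = (\<Sigma>\<^sub>{pa(j)})\<^sup>-\<^sup>1 \<Gamma>\<^sub>{pa(j),j}\<close>, and the enlarged matrix is positive definite iff the Schur complement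
  \<open>\<Gamma>\<^sub>j\<^sub>j - b\<^sup>T \<Gamma>\<^sub>{pa(j),j}\<close> is positive; that number only involves the complete set \<open>{j} \<union> pa(j)\<close>.

  If two parents \<open>i > j\<close> of \<open>k\<close> are not adjacent, take the identity with \<open>4/5\<close> at the edges \<open>ik\<close> and
  \<open>jk\<close>. No clique contains both edges, so this is partial positive definite. As \<open>k\<close> is not a parent
  of \<open>j\<close>, the Markov equation forces \<open>0\<close> at the position \<open>ij\<close> of any completion, and then
  the quadratic form at \<open>e\<^sub>i + e\<^sub>j - e\<^sub>k\<close> is \<open>3 - 16/5 < 0\<close>.
\<close>

section \<open>Positive definite submatrices and bordering by one index\<close>

lemma pos_def_on_sym: "pos_def_on A M \<Longrightarrow> i \<in> A \<Longrightarrow> j \<in> A \<Longrightarrow> M i j = M j i"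
  unfolding pos_def_on_def by blast

lemma pos_def_on_pos:
  "pos_def_on A M \<Longrightarrow> i \<in> A \<Longrightarrow> x i \<noteq> 0 \<Longrightarrow> (\<Sum>i\<in>A. \<Sum>j\<in>A. x i * M i j * x j) > 0"
  unfolding pos_def_on_def by blast

lemma pos_def_on_cong:
  assumes "\<And>i j. i \<in> A \<Longrightarrow> j \<in> A \<Longrightarrow> M i j = M' i j"
  shows "pos_def_on A M \<longleftrightarrow> pos_def_on A M'"
proof -
  have "(\<forall>i\<in>A. \<forall>j\<in>A. M i j = M j i) \<longleftrightarrow> (\<forall>i\<in>A. \<forall>j\<in>A. M' i j = M' j i)"
    by (intro ball_cong refl arg_cong2[where f = "(=)"] assms)
  moreover have "(\<Sum>i\<in>A. \<Sum>j\<in>A. x i * M i j * x j) = (\<Sum>i\<in>A. \<Sum>j\<in>A. x i * M' i j * x j)" for x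
    by (intro sum.cong refl) (simp only: assms)
  ultimately show ?thesis
    unfolding pos_def_on_def by (simp only:)
qed

lemma pos_def_on_subset:
  assumes "pos_def_on A M" "B \<subseteq> A" "finite A"
  shows "pos_def_on B M"
  unfolding pos_def_on_def
proof (intro conjI allI impI)
  show "\<forall>i\<in>B. \<forall>j\<in>B. M i j = M j i"
    using assms by (blast intro: pos_def_on_sym)
  fix x :: "nat \<Rightarrow> real"
  assume "\<exists>i\<in>B. x i \<noteq> 0"
  then obtain i where i: "i \<in> B" "x i \<noteq> 0" by blast
  \<comment> \<open>Extension of \<open>x\<close> by zero turns the form on \<open>B\<close> into
    the form on \<open>A\<close>.\<close>
  define y where "y k = (if k \<in> B then x k else 0)" for k
  have "(\<Sum>i\<in>A. \<Sum>j\<in>A. y i * M i j * y j) > 0"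
    using assms i by (intro pos_def_on_pos[of A M i]) (auto simp: y_def)
  also have "(\<Sum>i\<in>A. \<Sum>j\<in>A. y i * M i j * y j) = (\<Sum>i\<in>B. \<Sum>j\<in>A. y i * M i j * y j)"
    using assms by (intro sum.mono_neutral_right) (auto simp: y_def)
  also have "\<dots> = (\<Sum>i\<in>B. \<Sum>j\<in>B. y i * M i j * y j)"
    using assms by (intro sum.cong refl sum.mono_neutral_right) (auto simp: y_def)
  also have "\<dots> = (\<Sum>i\<in>B. \<Sum>j\<in>B. x i * M i j * x j)"
    by (simp add: y_def)
  finally show "(\<Sum>i\<in>B. \<Sum>j\<in>B. x i * M i j * x j) > 0" .
qed

text \<open>Completing the square. Since \<open>b\<close> solves the system whose right-hand side is
  the new column, shifting \<open>x\<close> by \<open>x a * b\<close> on \<open>A\<close> absorbs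
  all cross terms with \<open>a\<close>; what remains at \<open>x a ^ 2\<close> is the Schur
  complement.\<close>

lemma quadratic_form_insert:
  fixes M :: "'a \<Rightarrow> 'a \<Rightarrow> 'b::comm_ring_1"
  assumes "finite A" "a \<notin> A"
    and sym: "\<And>i j. i \<in> insert a A \<Longrightarrow> j \<in> insert a A \<Longrightarrow> M i j = M j i"
    and b: "\<And>i. i \<in> A \<Longrightarrow> (\<Sum>k\<in>A. M i k * b k) = M i a"
  shows "(\<Sum>i\<in>insert a A. \<Sum>j\<in>insert a A. x i * M i j * x j) =
         (\<Sum>i\<in>A. \<Sum>j\<in>A. (x i + x a * b i) * M i j * (x j + x a * b j))
         + x a ^ 2 * (M a a - (\<Sum>k\<in>A. b k * M k a))"
proof -
  define r where "r i = (\<Sum>j\<in>A. M i j * x j)" for i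
  \<comment> \<open>Symmetry of \<open>M\<close> lets it act on \<open>b\<close> instead of
    \<open>x\<close>, and \<open>M\<close> applied to \<open>b\<close> is the column of
    \<open>a\<close>.\<close>
  have swap: "(\<Sum>i\<in>A. b i * r i) = (\<Sum>i\<in>A. x i * M i a)"
  proof -
    have "(\<Sum>i\<in>A. b i * r i) = (\<Sum>j\<in>A. \<Sum>i\<in>A. b i * (M i j * x j))"
      unfolding r_def sum_distrib_left by (rule sum.swap)
    also have "\<dots> = (\<Sum>j\<in>A. x j * (\<Sum>i\<in>A. M j i * b i))"
      unfolding sum_distrib_left
      using sym by (intro sum.cong refl) (metis insertCI mult.assoc mult.commute)
    also have "\<dots> = (\<Sum>i\<in>A. x i * M i a)"
      using b by simp
    finally show ?thesis .
  qed
  have "(\<Sum>i\<in>A. \<Sum>j\<in>A. (x i + x a * b i) * M i j * (x j + x a * b j)) =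
      (\<Sum>i\<in>A. (x i + x a * b i) * (r i + x a * M i a))"
  proof (intro sum.cong refl)
    fix i assume "i \<in> A"
    show "(\<Sum>j\<in>A. (x i + x a * b i) * M i j * (x j + x a * b j)) =
        (x i + x a * b i) * (r i + x a * M i a)"
      unfolding b[OF \<open>i \<in> A\<close>, symmetric] r_def sum_distrib_left sum.distrib[symmetric]
      by (intro sum.cong refl) (simp add: algebra_simps)
  qed
  also have "\<dots> = (\<Sum>i\<in>A. x i * r i) + x a * (\<Sum>i\<in>A. x i * M i a)
      + x a * (\<Sum>i\<in>A. b i * r i) + x a ^ 2 * (\<Sum>i\<in>A. b i * M i a)"
    unfolding sum_distrib_left sum.distrib[symmetric]
    by (intro sum.cong refl) (simp add: algebra_simps power2_eq_square)
  finally have 1: "(\<Sum>i\<in>A. \<Sum>j\<in>A. (x i + x a * b i) * M i j * (x j + x a * b j)) =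
      (\<Sum>i\<in>A. x i * r i) + 2 * x a * (\<Sum>i\<in>A. x i * M i a) + x a ^ 2 * (\<Sum>i\<in>A. b i * M i a)"
    unfolding swap by (simp add: algebra_simps)
  have "(\<Sum>j\<in>A. x a * M a j * x j) = x a * (\<Sum>i\<in>A. x i * M i a)"
    unfolding sum_distrib_left
    using sym by (intro sum.cong refl) (metis insertCI mult.assoc mult.commute)
  moreover have "(\<Sum>i\<in>A. x i * M i a * x a) = x a * (\<Sum>i\<in>A. x i * M i a)"
    unfolding sum_distrib_left by (simp add: ac_simps)
  moreover have "(\<Sum>i\<in>A. \<Sum>j\<in>A. x i * M i j * x j) = (\<Sum>i\<in>A. x i * r i)"
    unfolding r_def sum_distrib_left by (simp add: ac_simps)
  ultimately have "(\<Sum>i\<in>insert a A. \<Sum>j\<in>insert a A. x i * M i j * x j) =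
      x a ^ 2 * M a a + 2 * x a * (\<Sum>i\<in>A. x i * M i a) + (\<Sum>i\<in>A. x i * r i)"
    using assms(1,2) by (simp add: sum.distrib algebra_simps power2_eq_square)
  then show ?thesis
    unfolding 1 by (simp add: algebra_simps)
qed

text \<open>After completing the square both summands are nonnegative. If \<open>x a\<close> is
  nonzero the Schur term is positive; otherwise no shift takes place and the form on
  \<open>A\<close> is positive. Taking a solution \<open>b\<close> instead of an inverse of the
  whole block allows a \<open>b\<close> supported on the parents of the new vertex.\<close>

lemma pos_def_on_insert:
  assumes "finite A" "a \<notin> A" "pos_def_on A M"
    and sym: "\<And>i. i \<in> A \<Longrightarrow> M a i = M i a"
    and b: "\<And>i. i \<in> A \<Longrightarrow> (\<Sum>k\<in>A. M i k * b k) = M i a"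
    and schur: "M a a - (\<Sum>k\<in>A. b k * M k a) > 0"
  shows "pos_def_on (insert a A) M"
  unfolding pos_def_on_def
proof (intro conjI allI impI)
  show sym': "\<forall>i\<in>insert a A. \<forall>j\<in>insert a A. M i j = M j i"
    using sym pos_def_on_sym[OF assms(3)] by auto
  fix x :: "nat \<Rightarrow> real"
  assume ex: "\<exists>i\<in>insert a A. x i \<noteq> 0"
  let ?y = "\<lambda>i. x i + x a * b i"
  have eq: "(\<Sum>i\<in>insert a A. \<Sum>j\<in>insert a A. x i * M i j * x j) =
      (\<Sum>i\<in>A. \<Sum>j\<in>A. ?y i * M i j * ?y j) + x a ^ 2 * (M a a - (\<Sum>k\<in>A. b k * M k a))"
    by (rule quadratic_form_insert[OF assms(1,2)]) (use sym' b in blast)+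
  show "(\<Sum>i\<in>insert a A. \<Sum>j\<in>insert a A. x i * M i j * x j) > 0"
  proof (cases "x a = 0")
    case True
    with ex obtain i where "i \<in> A" "x i \<noteq> 0" by auto
    then show ?thesis
      unfolding eq using pos_def_on_pos[OF assms(3), of i x] True by simp
  next
    case False
    have "(\<Sum>i\<in>A. \<Sum>j\<in>A. ?y i * M i j * ?y j) \<ge> 0"
    proof (cases "\<exists>i\<in>A. ?y i \<noteq> 0")
      case True
      then obtain i where "i \<in> A" "?y i \<noteq> 0" by blast
      then show ?thesis
        using pos_def_on_pos[OF assms(3), of i ?y] by simp
    next
      case False
      then have "(\<Sum>i\<in>A. \<Sum>j\<in>A. ?y i * M i j * ?y j) = 0"
        by (intro sum.neutral ballI) simp
      then show ?thesis by simp
    qed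
    moreover have "x a ^ 2 * (M a a - (\<Sum>k\<in>A. b k * M k a)) > 0"
      using False schur by simp
    ultimately show ?thesis
      unfolding eq by linarith
  qed
qed

text \<open>The vector with entry \<open>1\<close> at \<open>a\<close> and \<open>- b\<close> on
  \<open>A\<close> makes the shifted vector vanish, so the form takes exactly the value of the Schur
  complement there.\<close>

lemma schur_complement_pos:
  assumes "finite A" "a \<notin> A" "pos_def_on (insert a A) M"
    and b: "\<And>i. i \<in> A \<Longrightarrow> (\<Sum>k\<in>A. M i k * b k) = M i a"
  shows "M a a - (\<Sum>k\<in>A. b k * M k a) > 0"
proof -
  define x where "x i = (if i = a then 1 else - b i)" for i
  have "(\<Sum>i\<in>insert a A. \<Sum>j\<in>insert a A. x i * M i j * x j) =
      (\<Sum>i\<in>A. \<Sum>j\<in>A. (x i + x a * b i) * M i j * (x j + x a * b j))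
      + x a ^ 2 * (M a a - (\<Sum>k\<in>A. b k * M k a))"
    by (rule quadratic_form_insert[OF assms(1,2)]) (use pos_def_on_sym[OF assms(3)] b in blast)+
  also have "(\<Sum>i\<in>A. \<Sum>j\<in>A. (x i + x a * b i) * M i j * (x j + x a * b j)) = 0"
    using assms(2) by (intro sum.neutral ballI) (auto simp: x_def)
  finally show ?thesis
    using pos_def_on_pos[OF assms(3), of a x] by (simp add: x_def)
qed

text \<open>Block elimination, one index at a time: the pivot is a Schur complement, hence
  nonzero.\<close>

lemma pos_def_on_solvable:
  assumes "finite A" "pos_def_on A M"
  shows "\<exists>b. \<forall>i\<in>A. (\<Sum>k\<in>A. M i k * b k) = c i"
  using assms
proof (induction A arbitrary: c rule: finite_induct)
  case empty
  then show ?case by simp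
next
  case (insert a A)
  have pd: "pos_def_on A M"
    using insert.prems by (rule pos_def_on_subset) (use insert.hyps in auto)
  obtain u where u: "\<And>i. i \<in> A \<Longrightarrow> (\<Sum>k\<in>A. M i k * u k) = c i"
    using insert.IH[OF pd, of c] by blast
  obtain v where v: "\<And>i. i \<in> A \<Longrightarrow> (\<Sum>k\<in>A. M i k * v k) = M i a"
    using insert.IH[OF pd, of "\<lambda>i. M i a"] by blast
  have "M a a - (\<Sum>k\<in>A. v k * M k a) > 0"
    by (rule schur_complement_pos[OF insert.hyps insert.prems v])
  moreover have "(\<Sum>k\<in>A. v k * M k a) = (\<Sum>k\<in>A. M a k * v k)"
    using pos_def_on_sym[OF insert.prems] by (intro sum.cong refl) (simp add: mult.commute)
  ultimately have s: "M a a - (\<Sum>k\<in>A. M a k * v k) \<noteq> 0" by simp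
  \<comment> \<open>\<open>u\<close> solves the rows in \<open>A\<close> when the unknown at
    \<open>a\<close> is zero; giving that unknown the value \<open>t\<close> is compensated by
    subtracting \<open>t * v\<close>. Row \<open>a\<close> then determines \<open>t\<close>.\<close>
  define t where "t = (c a - (\<Sum>k\<in>A. M a k * u k)) / (M a a - (\<Sum>k\<in>A. M a k * v k))"
  define b where "b i = (if i = a then t else u i - t * v i)" for i
  have row: "(\<Sum>k\<in>insert a A. M i k * b k) =
      M i a * t + (\<Sum>k\<in>A. M i k * u k) - t * (\<Sum>k\<in>A. M i k * v k)" for i
  proof -
    have "(\<Sum>k\<in>A. M i k * b k) = (\<Sum>k\<in>A. M i k * u k - t * (M i k * v k))"
      using insert.hyps by (intro sum.cong refl) (auto simp: b_def algebra_simps)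
    then show ?thesis
      using insert.hyps by (simp add: b_def sum_subtractf sum_distrib_left)
  qed
  have "t * (M a a - (\<Sum>k\<in>A. M a k * v k)) = c a - (\<Sum>k\<in>A. M a k * u k)"
    using s by (simp add: t_def)
  then have "(\<Sum>k\<in>insert a A. M a k * b k) = c a"
    unfolding row by (simp add: algebra_simps)
  moreover have "(\<Sum>k\<in>insert a A. M i k * b k) = c i" if "i \<in> A" for i
    unfolding row u[OF that] v[OF that] by simp
  ultimately show ?case by blast
qed

section \<open>Inverses of positive definite submatrices\<close>

text \<open>Associativity: L = L(MR) = (LM)R = R on \<open>A\<close>.\<close>

lemma matrix_left_inverse_eq_right_inverse:
  fixes M :: "'a \<Rightarrow> 'a \<Rightarrow> 'b::comm_ring_1"
  assumes "finite A"
    and L: "\<And>i j. i \<in> A \<Longrightarrow> j \<in> A \<Longrightarrow> (\<Sum>k\<in>A. L i k * M k j) = (if i = j then 1 else 0)"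
    and R: "\<And>i j. i \<in> A \<Longrightarrow> j \<in> A \<Longrightarrow> (\<Sum>k\<in>A. M i k * R k j) = (if i = j then 1 else 0)"
    and "i \<in> A" "j \<in> A"
  shows "L i j = R i j"
proof -
  have "L i j = (\<Sum>k\<in>A. L i k * (if k = j then 1 else 0))"
    using assms by (simp add: if_distrib[of "(*) _"] cong: if_cong)
  also have "\<dots> = (\<Sum>k\<in>A. L i k * (\<Sum>l\<in>A. M k l * R l j))"
    using R \<open>j \<in> A\<close> by (intro sum.cong refl) simp
  also have "\<dots> = (\<Sum>l\<in>A. \<Sum>k\<in>A. L i k * (M k l * R l j))"
    unfolding sum_distrib_left by (rule sum.swap)
  also have "\<dots> = (\<Sum>l\<in>A. (\<Sum>k\<in>A. L i k * M k l) * R l j)"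
    unfolding sum_distrib_right by (simp add: mult.assoc)
  also have "\<dots> = (\<Sum>l\<in>A. (if i = l then 1 else 0) * R l j)"
    using L \<open>i \<in> A\<close> by (intro sum.cong refl) simp
  also have "\<dots> = R i j"
    using assms by (simp add: if_distrib[of "\<lambda>x. x * _"] cong: if_cong)
  finally show ?thesis .
qed

text \<open>Justifies the definite description: solving for unit vectors gives the columns of an
  inverse, two-sidedness follows from symmetry, and the zero padding makes it unique as a
  function.\<close>

lemma submatrix_inv_right:
  assumes "finite A" "pos_def_on A M" "i \<in> A" "j \<in> A"
  shows "(\<Sum>k\<in>A. M i k * submatrix_inv A M k j) = (if i = j then 1 else 0)"
proof -
  let ?P = "\<lambda>N. (\<forall>i\<in>A. \<forall>j\<in>A. (\<Sum>k\<in>A. M i k * N k j) = (if i = j then 1 else 0)) \<and>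
     (\<forall>i\<in>A. \<forall>j\<in>A. (\<Sum>k\<in>A. N i k * M k j) = (if i = j then 1 else 0)) \<and>
     (\<forall>i j. i \<notin> A \<or> j \<notin> A \<longrightarrow> N i j = 0)"
  have "\<forall>j. \<exists>b. \<forall>i\<in>A. (\<Sum>k\<in>A. M i k * b k) = (if i = j then 1 else 0)"
    by (intro allI pos_def_on_solvable[OF assms(1,2)])
  then obtain B where B: "\<And>i j. i \<in> A \<Longrightarrow> (\<Sum>k\<in>A. M i k * B j k) = (if i = j then 1 else 0)"
    by metis
  \<comment> \<open>By symmetry of \<open>M\<close>, the transpose of a right inverse is a left inverse.\<close>
  have left: "(\<Sum>k\<in>A. B i k * M k j) = (if i = j then 1 else 0)" if "i \<in> A" "j \<in> A" for i j
  proof -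
    have "(\<Sum>k\<in>A. B i k * M k j) = (\<Sum>k\<in>A. M j k * B i k)"
      using pos_def_on_sym[OF assms(2)] that
      by (intro sum.cong refl) (simp add: mult.commute)
    then show ?thesis
      using B[of j i] that by auto
  qed
  \<comment> \<open>\<open>B\<close> is a left inverse and its transpose a right inverse, so the two
    agree on \<open>A\<close>.\<close>
  have Bsym: "B i j = B j i" if "i \<in> A" "j \<in> A" for i j
    using assms(1) left B that
    by (intro matrix_left_inverse_eq_right_inverse[of A B M "\<lambda>i j. B j i"]) auto
  define N where "N i j = (if i \<in> A \<and> j \<in> A then B i j else 0)" for i j
  have "(\<Sum>k\<in>A. M i k * N k j) = (if i = j then 1 else 0)" if "i \<in> A" "j \<in> A" for i j
  proof -
    have "(\<Sum>k\<in>A. M i k * N k j) = (\<Sum>k\<in>A. M i k * B j k)"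
      using that Bsym by (intro sum.cong refl) (simp add: N_def)
    then show ?thesis
      using B that by simp
  qed
  moreover have "(\<Sum>k\<in>A. N i k * M k j) = (if i = j then 1 else 0)" if "i \<in> A" "j \<in> A" for i j
    using left[OF that] that by (simp add: N_def)
  ultimately have PN: "?P N"
    by (auto simp: N_def)
  have "?P (submatrix_inv A M)"
    unfolding submatrix_inv_def
  proof (rule theI[of ?P, OF PN])
    fix N' assume P': "?P N'"
    show "N' = N"
    proof (intro ext)
      fix i j
      show "N' i j = N i j"
      proof (cases "i \<in> A \<and> j \<in> A")
        case True
        then show ?thesis
          using PN P' assms(1)
          by (intro matrix_left_inverse_eq_right_inverse[of A N' M N]) blast+
      next
        case False
        then show ?thesis
          using PN P' by metis
      qed
    qed
  qed
  then show ?thesis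
    using assms(3,4) by blast
qed

lemma submatrix_inv_solves:
  assumes "finite A" "pos_def_on A M" "i \<in> A"
  shows "(\<Sum>k\<in>A. M i k * (\<Sum>l\<in>A. submatrix_inv A M k l * c l)) = c i"
proof -
  have "(\<Sum>k\<in>A. M i k * (\<Sum>l\<in>A. submatrix_inv A M k l * c l)) =
      (\<Sum>l\<in>A. \<Sum>k\<in>A. M i k * (submatrix_inv A M k l * c l))"
    unfolding sum_distrib_left by (rule sum.swap)
  also have "\<dots> = (\<Sum>l\<in>A. (\<Sum>k\<in>A. M i k * submatrix_inv A M k l) * c l)"
    unfolding sum_distrib_right by (simp add: mult.assoc)
  also have "\<dots> = (\<Sum>l\<in>A. (if i = l then 1 else 0) * c l)"
    using submatrix_inv_right[OF assms] by (intro sum.cong refl) simp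
  also have "\<dots> = c i"
    using assms by (simp add: if_distrib[of "\<lambda>x. x * _"] cong: if_cong)
  finally show ?thesis .
qed

text \<open>The predicates under the two definite descriptions are equal, so the padded inverses
  agree as functions. This lets the inverse on a parent set survive changes of the matrix
  elsewhere.\<close>

lemma submatrix_inv_cong:
  assumes "\<And>i j. i \<in> A \<Longrightarrow> j \<in> A \<Longrightarrow> M i j = M' i j"
  shows "submatrix_inv A M = submatrix_inv A M'"
proof -
  have "(\<forall>i\<in>A. \<forall>j\<in>A. (\<Sum>k\<in>A. M i k * N k j) = (if i = j then 1 else 0)) \<longleftrightarrow>
      (\<forall>i\<in>A. \<forall>j\<in>A. (\<Sum>k\<in>A. M' i k * N k j) = (if i = j then 1 else 0))" for N
    by (intro ball_cong refl arg_cong2[where f = "(=)"] sum.cong) (simp only: assms)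
  moreover have "(\<forall>i\<in>A. \<forall>j\<in>A. (\<Sum>k\<in>A. N i k * M k j) = (if i = j then 1 else 0)) \<longleftrightarrow>
      (\<forall>i\<in>A. \<forall>j\<in>A. (\<Sum>k\<in>A. N i k * M' k j) = (if i = j then 1 else 0))" for N
    by (intro ball_cong refl arg_cong2[where f = "(=)"] sum.cong) (simp only: assms)
  ultimately show ?thesis
    unfolding submatrix_inv_def by (simp only:)
qed

section \<open>Edges, parents and cliques\<close>

lemma undirected_edges_iff: "{i, j} \<in> undirected_edges E \<longleftrightarrow> (i, j) \<in> E \<or> (j, i) \<in> E"
  unfolding undirected_edges_def mem_Collect_eq doubleton_eq_iff by blast

lemma dag_edgeD:
  assumes "dag p E" "(i, j) \<in> E"
  shows "i \<in> {1..p}" "j \<in> {1..p}" "i \<ge> j"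
  using assms unfolding dag_def by (cases "i = j"; auto simp: less_imp_le)+

lemma pa_greater:
  assumes "dag p E" "i \<in> pa E j"
  shows "j < i" "i \<le> p"
  using assms dag_edgeD[of p E i j] unfolding pa_def by auto

text \<open>There are only finitely many complete supersets of \<open>C\<close>, so one of them is
  maximal.\<close>

lemma pairwise_adjacent_subset_clique:
  assumes "pairwise_adjacent p E C"
  obtains K where "clique p E K" "C \<subseteq> K"
proof -
  let ?S = "{C'. pairwise_adjacent p E C' \<and> C \<subseteq> C'}"
  have "finite ?S"
    by (rule finite_subset[of _ "Pow {1..p}"]) (auto simp: pairwise_adjacent_def)
  moreover have "?S \<noteq> {}"
    using assms by blast
  ultimately obtain K where K: "K \<in> ?S" "\<And>C'. C' \<in> ?S \<Longrightarrow> K \<subseteq> C' \<Longrightarrow> C' = K"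
    using finite_has_maximal[of ?S] by metis
  then have "clique p E K"
    unfolding clique_def by blast
  with K(1) show thesis
    using that by blast
qed

text \<open>\<open>Q_dag\<close> speaks of maximal complete sets only; a vertex with its parents may
  fail to be maximal, so positivity is inherited from a clique above it.\<close>

lemma Q_dag_pos_def_on:
  assumes "\<Gamma> \<in> Q_dag p E" "pairwise_adjacent p E C"
  shows "pos_def_on C \<Gamma>"
proof -
  obtain K where K: "clique p E K" "C \<subseteq> K"
    using assms(2) by (rule pairwise_adjacent_subset_clique)
  then have "pos_def_on K \<Gamma>"
    using assms(1) unfolding Q_dag_def by blast
  moreover have "finite K"
    using K(1) unfolding clique_def pairwise_adjacent_def by (blast intro: finite_subset)
  ultimately show ?thesis
    using K(2) pos_def_on_subset by blast
qed

text \<open>The point where perfectness enters the completion: it makes the family of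
  \<open>j\<close> complete, so that \<Gamma> is defined and positive definite on it.\<close>

lemma perfect_dag_family_pairwise_adjacent:
  assumes "perfect_dag p E" "j \<in> {1..p}"
  shows "pairwise_adjacent p E (insert j (pa E j))"
proof -
  have "dag p E"
    using assms(1) unfolding perfect_dag_def by blast
  then have "insert j (pa E j) \<subseteq> {1..p}"
    using assms(2) pa_greater[of p E _ j] by fastforce
  then show ?thesis
    using assms unfolding pairwise_adjacent_def perfect_dag_def undirected_edges_iff pa_def
    by blast
qed

section \<open>Completion over a perfect DAG\<close>

text \<open>The condition of \<open>PD_dag\<close> at a single vertex, so that the induction can
  carry it for the vertices already placed.\<close>

definition markov_at :: "nat \<Rightarrow> (nat \<times> nat) set \<Rightarrow> (nat \<Rightarrow> nat \<Rightarrow> real) \<Rightarrow> nat \<Rightarrow> bool" where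
  "markov_at p E S j \<longleftrightarrow> (\<forall>i\<in>pr p E j.
     S i j = (\<Sum>k\<in>pa E j. \<Sum>l\<in>pa E j. S i k * submatrix_inv (pa E j) S k l * S l j))"

text \<open>Parents and predecessors of \<open>j\<close> have larger labels, so the equation at
  \<open>j\<close> reads only entries with both indices at least \<open>j\<close>. Adding a smaller
  vertex later leaves it intact.\<close>

lemma markov_at_cong:
  assumes "dag p E" "\<And>i k. j \<le> i \<Longrightarrow> j \<le> k \<Longrightarrow> S i k = S' i k"
  shows "markov_at p E S j \<longleftrightarrow> markov_at p E S' j"
proof -
  have pa: "j \<le> k" if "k \<in> pa E j" for k
    using pa_greater(1)[OF assms(1) that] by simp
  have inv: "submatrix_inv (pa E j) S = submatrix_inv (pa E j) S'"
    using assms(2) pa by (intro submatrix_inv_cong) simp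
  show ?thesis
    unfolding markov_at_def inv
    using assms(2) pa by (simp add: pr_def)
qed

text \<open>The inductive step: vertex \<open>j\<close> joins a completion already built on the
  larger labels.\<close>

lemma extend_completion:
  assumes perf: "perfect_dag p E" and Q: "\<Gamma> \<in> Q_dag p E" and j: "j \<in> {1..p}"
    and pd: "pos_def_on {Suc j..p} S"
    and agree: "\<And>i k. (i, k) \<in> E \<Longrightarrow> j < k \<Longrightarrow> S i k = \<Gamma> i k"
    and markov: "\<And>k. k \<in> {Suc j..p} \<Longrightarrow> markov_at p E S k"
  obtains T where "pos_def_on {j..p} T"
    and "\<And>i k. (i, k) \<in> E \<Longrightarrow> j \<le> k \<Longrightarrow> T i k = \<Gamma> i k"
    and "\<And>k. k \<in> {j..p} \<Longrightarrow> markov_at p E T k"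
proof -
  let ?A = "{Suc j..p}" and ?P = "pa E j"
  have dag: "dag p E"
    using perf unfolding perfect_dag_def by blast
  have P: "?P \<subseteq> ?A"
    using pa_greater[OF dag] by (auto simp: Suc_le_eq)
  then have finP: "finite ?P"
    by (rule finite_subset) simp
  have adj: "pairwise_adjacent p E (insert j ?P)"
    using perf j by (rule perfect_dag_family_pairwise_adjacent)
  have pdG: "pos_def_on (insert j ?P) \<Gamma>"
    using Q adj by (rule Q_dag_pos_def_on)
  have pdP: "pos_def_on ?P S"
    using pd P by (rule pos_def_on_subset) simp
  \<comment> \<open>\<open>agree\<close> covers a pair of parents only in the direction of its edge;
    symmetry of both matrices gives the other direction.\<close>
  have SG: "S i k = \<Gamma> i k" if ik: "i \<in> ?P" "k \<in> ?P" for i k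
  proof -
    have gt: "j < i" "j < k"
      using ik P by auto
    have "(i, k) \<in> E \<or> (k, i) \<in> E"
      using adj ik dag j P unfolding pairwise_adjacent_def undirected_edges_iff dag_def
      by (cases "i = k") auto
    then show ?thesis
      using agree gt pos_def_on_sym[OF pdP ik] pos_def_on_sym[OF pdG, of i k] ik by auto
  qed
  \<comment> \<open>The value \<open>0\<close> off the parents lets sums over all larger labels
    collapse to sums over \<open>?P\<close>.\<close>
  define b where
    "b k = (if k \<in> ?P then \<Sum>l\<in>?P. submatrix_inv ?P S k l * \<Gamma> l j else 0)" for k
  \<comment> \<open>The column \<open>S\<close> times \<open>b\<close> serves two purposes: at
    parents it reproduces \<Gamma> because \<open>b\<close> solves the system there, and at
    predecessors it is the value prescribed by the Markov equation.\<close>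
  define T where "T i k =
     (if i = j \<and> k = j then \<Gamma> j j
      else if k = j then \<Sum>l\<in>?P. S i l * b l
      else if i = j then \<Sum>l\<in>?P. S k l * b l
      else S i k)" for i k
  have bP: "(\<Sum>k\<in>?P. S i k * b k) = \<Gamma> i j" if "i \<in> ?P" for i
    using submatrix_inv_solves[OF finP pdP that, of "\<lambda>l. \<Gamma> l j"] by (simp add: b_def)
  have jP: "j \<notin> ?P"
    using P by auto
  have TP: "T i j = \<Gamma> i j" if "i \<in> ?P" for i
    using bP[OF that] that jP by (auto simp: T_def)
  have TS: "T i k = S i k" if "i \<noteq> j" "k \<noteq> j" for i k
    using that by (simp add: T_def)
  have schurG: "\<Gamma> j j - (\<Sum>k\<in>?P. b k * \<Gamma> k j) > 0"
  proof (rule schur_complement_pos[OF finP jP pdG])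
    fix i assume "i \<in> ?P"
    then show "(\<Sum>k\<in>?P. \<Gamma> i k * b k) = \<Gamma> i j"
      using bP[of i] SG by simp
  qed
  have pdT: "pos_def_on (insert j ?A) T"
  proof (rule pos_def_on_insert[where b = b])
    show "pos_def_on ?A T"
      using pd by (rule pos_def_on_cong[THEN iffD1, rotated]) (simp add: TS)
    show "T j i = T i j" if "i \<in> ?A" for i
      using that by (auto simp: T_def)
    show "(\<Sum>k\<in>?A. T i k * b k) = T i j" if "i \<in> ?A" for i
    proof -
      have "(\<Sum>k\<in>?A. T i k * b k) = (\<Sum>k\<in>?P. T i k * b k)"
        using P by (intro sum.mono_neutral_right) (auto simp: b_def)
      also have "\<dots> = (\<Sum>k\<in>?P. S i k * b k)"
      proof (intro sum.cong refl arg_cong2[where f = "(*)"])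
        fix k assume "k \<in> ?P"
        then show "T i k = S i k"
          using that jP by (intro TS) auto
      qed
      finally show ?thesis
        using that by (auto simp: T_def)
    qed
    \<comment> \<open>Only parents contribute, and there column \<open>j\<close> of \<open>T\<close>
      is that of \<Gamma>; the Schur complement of \<open>T\<close> is therefore the one in
      \<open>schurG\<close>.\<close>
    have "(\<Sum>k\<in>?A. b k * T k j) = (\<Sum>k\<in>?P. b k * T k j)"
      using P by (intro sum.mono_neutral_right) (auto simp: b_def)
    then show "T j j - (\<Sum>k\<in>?A. b k * T k j) > 0"
      using schurG TP by (simp add: T_def)
  qed simp_all
  have markovT: "markov_at p E T j"
    unfolding markov_at_def
  proof
    fix i assume "i \<in> pr p E j"
    then have ij: "i \<noteq> j" by (simp add: pr_def)
    have inv: "submatrix_inv ?P T = submatrix_inv ?P S"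
      using jP by (intro submatrix_inv_cong TS) auto
    have "T i j = (\<Sum>k\<in>?P. S i k * (\<Sum>l\<in>?P. submatrix_inv ?P S k l * \<Gamma> l j))"
      using ij by (simp add: T_def b_def)
    also have "\<dots> = (\<Sum>k\<in>?P. \<Sum>l\<in>?P. T i k * submatrix_inv ?P T k l * T l j)"
      unfolding sum_distrib_left inv
    proof (intro sum.cong refl)
      fix k l assume kl: "k \<in> ?P" "l \<in> ?P"
      then have "T i k = S i k"
        using ij jP by (intro TS) auto
      then show "S i k * (submatrix_inv ?P S k l * \<Gamma> l j) =
          T i k * submatrix_inv ?P S k l * T l j"
        using TP kl by simp
    qed
    finally show "T i j = (\<Sum>k\<in>?P. \<Sum>l\<in>?P. T i k * submatrix_inv ?P T k l * T l j)" .
  qed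
  show thesis
  proof (rule that[of T])
    show "pos_def_on {j..p} T"
      using pdT j by (simp add: atLeastAtMost_insertL)
    show "T i k = \<Gamma> i k" if "(i, k) \<in> E" "j \<le> k" for i k
    proof (cases "k = j")
      case True
      then show ?thesis
        using that TP by (cases "i = j") (auto simp: T_def pa_def)
    next
      case False
      \<comment> \<open>Edges run from larger to smaller labels, so \<open>i\<close> also exceeds
        \<open>j\<close> and the entry lies outside the new row and column.\<close>
      then show ?thesis
        using that agree[of i k] dag_edgeD(3)[OF dag that(1)] TS[of i k] by simp
    qed
    show "markov_at p E T k" if "k \<in> {j..p}" for k
    proof (cases "k = j")
      case False
      then have "markov_at p E S k"
        using markov that by simp
      then show ?thesis
        using dag by (rule markov_at_cong[THEN iffD1, rotated 2])
          (use False that TS in auto)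
    qed (use markovT in simp)
  qed
qed

lemma perfect_dag_completable:
  assumes perf: "perfect_dag p E" and Q: "\<Gamma> \<in> Q_dag p E"
  shows "completable_in E \<Gamma> (PD_dag p E)"
proof -
  have dag: "dag p E"
    using perf unfolding perfect_dag_def by blast
  \<comment> \<open>\<open>n\<close> counts the vertices placed. For \<open>n = 0\<close> the
    interval is empty and no edge ends above \<open>p\<close>; for \<open>n = p\<close> it is all of
    \<open>{1..p}\<close>.\<close>
  have "\<exists>S. pos_def_on {Suc p - n..p} S \<and>
      (\<forall>i k. (i, k) \<in> E \<and> Suc p - n \<le> k \<longrightarrow> S i k = \<Gamma> i k) \<and>
      (\<forall>k\<in>{Suc p - n..p}. markov_at p E S k)" if "n \<le> p" for n
    using that
  proof (induction n)
    case 0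
    then show ?case
      using dag_edgeD(2)[OF dag] by (auto simp: pos_def_on_def)
  next
    case (Suc n)
    define j where "j = p - n"
    have j: "j \<in> {1..p}" "Suc p - n = Suc j" "Suc p - Suc n = j"
      using Suc.prems by (auto simp: j_def)
    obtain S where "pos_def_on {Suc j..p} S"
      "\<And>i k. (i, k) \<in> E \<Longrightarrow> j < k \<Longrightarrow> S i k = \<Gamma> i k"
      "\<And>k. k \<in> {Suc j..p} \<Longrightarrow> markov_at p E S k"
      using Suc.IH Suc.prems unfolding j(2) by (auto simp: Suc_le_eq)
    from extend_completion[OF perf Q j(1) this] show ?case
      unfolding j(3) by metis
  qed
  from this[of p] obtain S where S: "pos_def_on {1..p} S"
      "\<And>i k. (i, k) \<in> E \<Longrightarrow> 1 \<le> k \<Longrightarrow> S i k = \<Gamma> i k"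
      "\<And>k. k \<in> {1..p} \<Longrightarrow> markov_at p E S k"
    by auto
  have "S \<in> PD_dag p E"
    using S(1,3) unfolding PD_dag_def markov_at_def by blast
  moreover have "\<forall>(i, k)\<in>E. S i k = \<Gamma> i k"
    using S(2) dag_edgeD(2)[OF dag] by auto
  ultimately show ?thesis
    unfolding completable_in_def by blast
qed

section \<open>The counterexample for two nonadjacent parents\<close>

text \<open>Any weight c strictly between 3/4 and 1 would serve: c < 1 keeps the block of a single
  edge positive definite, and c > 3/4 makes the value 3 - 4c of the final quadratic form
  negative.\<close>

definition vstruct_matrix :: "nat \<Rightarrow> nat \<Rightarrow> nat \<Rightarrow> nat \<Rightarrow> nat \<Rightarrow> real" where
  "vstruct_matrix i j k r s =
     (if r = s then 1 else if {r, s} = {i, k} \<or> {r, s} = {j, k} then 4/5 else 0)"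

lemma vstruct_matrix_sym: "vstruct_matrix i j k r s = vstruct_matrix i j k s r"
  unfolding vstruct_matrix_def by (cases "r = s") (auto simp: doubleton_eq_iff)

lemma pos_def_on_identity:
  assumes "finite A" "\<And>r s. r \<in> A \<Longrightarrow> s \<in> A \<Longrightarrow> M r s = (if r = s then 1 else 0)"
  shows "pos_def_on A M"
  unfolding pos_def_on_def
proof (intro conjI allI impI)
  show "\<forall>i\<in>A. \<forall>j\<in>A. M i j = M j i"
    using assms(2) by simp
  fix x :: "nat \<Rightarrow> real"
  assume "\<exists>i\<in>A. x i \<noteq> 0"
  then obtain i where i: "i \<in> A" "x i \<noteq> 0" by blast
  have "(\<Sum>i\<in>A. \<Sum>j\<in>A. x i * M i j * x j) = (\<Sum>i\<in>A. \<Sum>j\<in>A. if i = j then x i ^ 2 else 0)"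
    using assms(2) by (intro sum.cong refl) (simp add: power2_eq_square)
  also have "\<dots> = (\<Sum>i\<in>A. x i ^ 2)"
    using assms(1) by simp
  also have "\<dots> > 0"
    using i assms(1) by (intro sum_pos2[of A i]) auto
  finally show "(\<Sum>i\<in>A. \<Sum>j\<in>A. x i * M i j * x j) > 0" .
qed

text \<open>At most one of the two weighted edges lies inside \<open>C\<close>. Without
  \<open>k\<close> the block is the identity; bordering the identity by \<open>k\<close> gives a
  Schur complement of at least 1 - 16/25.\<close>

lemma pos_def_on_vstruct_matrix:
  assumes "finite C" "i \<noteq> j" "i \<noteq> k" "j \<noteq> k" "\<not> (i \<in> C \<and> j \<in> C)"
  shows "pos_def_on C (vstruct_matrix i j k)"
proof (cases "k \<in> C")
  case False
  then show ?thesis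
    using assms by (intro pos_def_on_identity) (auto simp: vstruct_matrix_def doubleton_eq_iff)
next
  case True
  let ?G = "vstruct_matrix i j k" and ?A = "C - {k}"
  define b where "b l = (if l = i \<or> l = j then 4/5 else 0 :: real)" for l
  have col: "?G l k = b l" if "l \<in> ?A" for l
    using that by (auto simp: vstruct_matrix_def b_def doubleton_eq_iff)
  have id: "?G r s = (if r = s then 1 else 0)" if "r \<in> ?A" "s \<in> ?A" for r s
    using that by (auto simp: vstruct_matrix_def doubleton_eq_iff)
  have "pos_def_on (insert k ?A) ?G"
  proof (rule pos_def_on_insert[where b = b])
    show "pos_def_on ?A ?G"
      using assms(1) id by (intro pos_def_on_identity) auto
    show "?G k r = ?G r k" for r
      by (rule vstruct_matrix_sym)
    show "(\<Sum>l\<in>?A. ?G r l * b l) = ?G r k" if "r \<in> ?A" for r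
    proof -
      have "(\<Sum>l\<in>?A. ?G r l * b l) = (\<Sum>l\<in>?A. if r = l then b l else 0)"
        using id that by (intro sum.cong refl) auto
      then show ?thesis
        using assms(1) that col by simp
    qed
    have "(\<Sum>l\<in>?A. b l * ?G l k) = (\<Sum>l\<in>?A. b l ^ 2)"
      using col by (intro sum.cong refl) (simp add: power2_eq_square)
    also have "\<dots> = (\<Sum>l\<in>?A \<inter> {i, j}. b l ^ 2)"
      using assms(1) by (intro sum.mono_neutral_right) (auto simp: b_def)
    also have "\<dots> \<le> 16/25"
    proof -
      have "?A \<inter> {i, j} \<subseteq> {i} \<or> ?A \<inter> {i, j} \<subseteq> {j}"
        using assms(5) by blast
      then obtain B where B: "?A \<inter> {i, j} = B" "B \<in> {{}, {i}, {j}}"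
        by blast
      show ?thesis
        unfolding B(1) using B(2) by (auto simp: b_def power2_eq_square)
    qed
    finally show "?G k k - (\<Sum>l\<in>?A. b l * ?G l k) > 0"
      by (simp add: vstruct_matrix_def)
  qed (use assms(1) in auto)
  then show ?thesis
    using True by (simp add: insert_absorb)
qed

text \<open>The order \<open>j < i\<close> makes \<open>i\<close> a predecessor of \<open>j\<close>,
  so the Markov equation at \<open>j\<close> governs the missing position.\<close>

lemma vstruct_matrix_not_completable:
  assumes dag: "dag p E" and i: "i \<in> pa E k" and j: "j \<in> pa E k"
    and "j < i" and nonadj: "{i, j} \<notin> undirected_edges E"
  shows "vstruct_matrix i j k \<in> Q_dag p E"
    and "\<not> completable_in E (vstruct_matrix i j k) (PD_dag p E)"
proof -
  let ?G = "vstruct_matrix i j k"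
  have neq: "i \<noteq> j" "i \<noteq> k" "j \<noteq> k"
    using \<open>j < i\<close> i j by (auto simp: pa_def)
  have "pos_def_on C ?G" if "clique p E C" for C
  proof (rule pos_def_on_vstruct_matrix)
    show "finite C"
      using that unfolding clique_def pairwise_adjacent_def by (blast intro: finite_subset)
    show "\<not> (i \<in> C \<and> j \<in> C)"
      using that nonadj neq unfolding clique_def pairwise_adjacent_def by blast
  qed (fact neq)+
  then show "?G \<in> Q_dag p E"
    unfolding Q_dag_def partial_matrix_def using vstruct_matrix_sym by blast
  show "\<not> completable_in E ?G (PD_dag p E)"
  proof
    assume "completable_in E ?G (PD_dag p E)"
    then obtain T where T: "T \<in> PD_dag p E" "\<And>r s. (r, s) \<in> E \<Longrightarrow> T r s = ?G r s"
      unfolding completable_in_def by blast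
    have pd: "pos_def_on {1..p} T"
      using T(1) unfolding PD_dag_def by blast
    have E: "(i, k) \<in> E" "(j, k) \<in> E"
      using i j by (auto simp: pa_def)
    have V: "i \<in> {1..p}" "j \<in> {1..p}" "k \<in> {1..p}"
      using dag_edgeD[OF dag] E by blast+
    have "i \<in> pr p E j"
      using V nonadj \<open>j < i\<close> unfolding pr_def pa_def undirected_edges_iff by blast
    then have "T i j = (\<Sum>r\<in>pa E j. \<Sum>s\<in>pa E j. T i r * submatrix_inv (pa E j) T r s * T s j)"
      using T(1) V unfolding PD_dag_def by blast
    \<comment> \<open>The last factor is an edge entry, hence prescribed, and in column
      \<open>j\<close> only row \<open>k\<close> has a nonzero prescribed entry off the diagonal.
      But \<open>k\<close> is smaller than its parent \<open>j\<close> and so is no parent of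
      \<open>j\<close>.\<close>
    also have "\<dots> = 0"
    proof (intro sum.neutral ballI)
      fix r s assume "s \<in> pa E j"
      then have s: "(s, j) \<in> E" "j < s"
        using pa_greater(1)[OF dag] by (auto simp: pa_def)
      moreover have "s \<noteq> k"
        using s(2) pa_greater(1)[OF dag j] by auto
      ultimately have "T s j = 0"
        using T(2)[OF s(1)] neq by (auto simp: vstruct_matrix_def doubleton_eq_iff)
      then show "T i r * submatrix_inv (pa E j) T r s * T s j = 0" by simp
    qed
    finally have Tij: "T i j = 0" .
    have diag: "T r r = 1" if "r \<in> {1..p}" for r
    proof -
      have "(r, r) \<in> E"
        using that dag unfolding dag_def by blast
      then show ?thesis
        using T(2) by (simp add: vstruct_matrix_def)
    qed
    have Tk: "T i k = 4/5" "T j k = 4/5"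
      using T(2) E neq by (auto simp: vstruct_matrix_def)
    have "pos_def_on {i, j, k} T"
      using pd V by (intro pos_def_on_subset[OF pd]) auto
    then have "(\<Sum>r\<in>{i, j, k}. \<Sum>s\<in>{i, j, k}.
        (if r = k then - 1 else 1) * T r s * (if s = k then - 1 else 1)) > 0"
      by (rule pos_def_on_pos[where i = k]) auto
    moreover have "T j i = 0" "T k i = 4/5" "T k j = 4/5"
      using pos_def_on_sym[OF pd] V Tij Tk by metis+
    ultimately show False
      using neq Tij Tk diag V by simp
  qed
qed

theorem theorem4p1:
  fixes p :: nat and E :: "(nat \<times> nat) set"
  assumes "dag p E"
  shows "(\<forall>\<Gamma>\<in>Q_dag p E. completable_in E \<Gamma> (PD_dag p E)) \<longleftrightarrow> perfect_dag p E"
proof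
  assume compl: "\<forall>\<Gamma>\<in>Q_dag p E. completable_in E \<Gamma> (PD_dag p E)"
  have adj: "{i, j} \<in> undirected_edges E" if "i \<in> pa E k" "j \<in> pa E k" "j < i" for i j k
    using vstruct_matrix_not_completable[OF assms that] compl by blast
  have "{i, j} \<in> undirected_edges E" if "i \<in> pa E k" "j \<in> pa E k" "i \<noteq> j" for i j k
    using adj[of i k j] adj[of j k i] that by (metis insert_commute linorder_neq_iff)
  then show "perfect_dag p E"
    unfolding perfect_dag_def using assms by blast
next
  assume "perfect_dag p E"
  then show "\<forall>\<Gamma>\<in>Q_dag p E. completable_in E \<Gamma> (PD_dag p E)"
    using perfect_dag_completable by blast
qed

end
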